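(* Let $m,d$ be positive integers and suppose there exists a Langford sequence $L=(l_1,l_2,\ldots,l_{2m})$ of order $m$ and defect $d$. Then for each odd positive integer $n$ there exists a Langford sequence $L'$ of order $mn$ and defect $d'=nd-(n-1)/2$.
   Context: For integers $a\le b$, $[a,b]=\{a,a+1,\ldots,b\}$. Let $d$ be a positive integer. A Langford sequence of order $m$ and defect $d$ is a sequence $(l_1,\ldots,l_{2m})$ of $2m$ integers such that (i) for every $k\in[d,d+m-1]$ there are exactly two subscripts $i,j\in[1,2m]$ with $l_i=l_j=k$, and (ii) these subscripts satisfy $|i-j|=k$. *)

theory Defs
  imports Main
begin

(* The sequence (l_1, ..., l_{2m}) is a list, so l_i is L ! (i - 1); the shift of subscripts
   by one leaves their differences unchanged. *)
definition langford_sequence :: "nat \<Rightarrow> int \<Rightarrow> int list \<Rightarrow> bool" where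
  "langford_sequence m d L \<longleftrightarrow>
     0 < d \<and> length L = 2 * m \<and>
     (\<forall>k \<in> {d .. d + int m - 1}.
        \<exists>i j. i \<noteq> j \<and> {t. t < 2 * m \<and> L ! t = k} = {i, j} \<and> \<bar>int i - int j\<bar> = k)"

end

theory Submission
  imports Defs
begin

text \<open>
  Replace every position \<open>p\<close> of \<open>L\<close> by a block of \<open>n = 2 * r + 1\<close> positions \<open>n * p + a\<close>. If \<open>k\<close>
  occupies the positions \<open>i < j\<close>, pair \<open>n * i + a\<close> with \<open>n * j + \<sigma> a\<close> for a permutation \<open>\<sigma>\<close> of
  \<open>{0..<n}\<close>; the distance is \<open>n * k + (\<sigma> a - a)\<close>. If the displacements \<open>\<sigma> a - a\<close> run through
  \<open>{-r..r}\<close>, the distances fill \<open>{n * k - r..n * k + r}\<close>, and these intervals for consecutive \<open>k\<close>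
  tile the interval required. Such a \<open>\<sigma>\<close> reverses \<open>{0..r}\<close> and \<open>{r + 1..2 * r}\<close> separately, which
  yields the displacements congruent to \<open>r\<close> modulo 2 and the remaining ones, respectively.
\<close>

definition rev_halves :: "nat \<Rightarrow> nat \<Rightarrow> nat" where
  "rev_halves r a = (if a \<le> r then r - a else 3 * r + 1 - a)"

definition displacement :: "nat \<Rightarrow> nat \<Rightarrow> int" where
  "displacement r a = int (rev_halves r a) - int a"

lemma rev_halves_less: "a < 2 * r + 1 \<Longrightarrow> rev_halves r a < 2 * r + 1"
  by (auto simp: rev_halves_def)

lemma rev_halves_rev_halves: "a < 2 * r + 1 \<Longrightarrow> rev_halves r (rev_halves r a) = a"
  by (auto simp: rev_halves_def)

lemma displacement_rev_halves:
  "a < 2 * r + 1 \<Longrightarrow> displacement r (rev_halves r a) = - displacement r a"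
  by (simp add: displacement_def rev_halves_rev_halves)

lemma displacement_eq:
  assumes "a < 2 * r + 1"
  shows "displacement r a = (if a \<le> r then int r - 2 * int a else 3 * int r + 1 - 2 * int a)"
  using assms by (auto simp: displacement_def rev_halves_def)

lemma abs_displacement_le: "a < 2 * r + 1 \<Longrightarrow> \<bar>displacement r a\<bar> \<le> int r"
  by (auto simp: displacement_eq)

text \<open>On each half the displacement falls by 2 at every step, and the parities on the two
  halves differ, since \<open>3 * r + 1\<close> and \<open>r\<close> have opposite parity.\<close>

lemma inj_on_displacement: "inj_on (displacement r) {..<2 * r + 1}"
proof (rule inj_onI)
  fix a b assume "a \<in> {..<2 * r + 1}" "b \<in> {..<2 * r + 1}" "displacement r a = displacement r b"
  then show "a = b" by (simp add: displacement_eq split: if_splits) presburger+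
qed

lemma displacement_surj:
  assumes "\<bar>e\<bar> \<le> int r"
  obtains a where "a < 2 * r + 1" "displacement r a = e"
proof (cases "even (int r - e)")
  case True
  then obtain c where "int r - e = 2 * c" by (elim evenE)
  with assms show thesis
    by (intro that[of "nat c"]) (auto simp: displacement_eq)
next
  case False
  then obtain c where "int r - e = 2 * c + 1" by (elim oddE)
  \<comment> \<open>The witness solves \<open>3 * r + 1 - 2 * a = e\<close>; here
    \<open>0 \<le> c < r\<close>, so it lies in the second half.\<close>
  with assms show thesis
    by (intro that[of "nat (int r + 1 + c)"]) (auto simp: displacement_eq)
qed

text \<open>Adding \<open>r\<close> moves \<open>e\<close> and \<open>f\<close> into
  \<open>{0..2 * r}\<close>, where they are remainders modulo \<open>2 * r + 1\<close>. Hence an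
  entry of the inflated list reveals the original entry and its signed displacement.\<close>

lemma int_block_unique:
  fixes k l e f :: int
  assumes "(2 * int r + 1) * k + e = (2 * int r + 1) * l + f" "\<bar>e\<bar> \<le> int r" "\<bar>f\<bar> \<le> int r"
  shows "k = l \<and> e = f"
proof -
  have "(e + int r + (2 * int r + 1) * k) div (2 * int r + 1) = k"
    "(f + int r + (2 * int r + 1) * l) div (2 * int r + 1) = l"
    using assms(2,3) by (auto simp: div_mult_self2 div_pos_pos_trivial)
  moreover have "e + int r + (2 * int r + 1) * k = f + int r + (2 * int r + 1) * l"
    using assms(1) by simp
  ultimately have "k = l" by metis
  with assms(1) show ?thesis by simp
qed

text \<open>
  As \<open>\<sigma>\<close> is an involution, the displacement at \<open>\<sigma> a\<close> is minus that at \<open>a\<close>, so the sign makes the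
  entry at \<open>n * j + \<sigma> a\<close> agree with the one at \<open>n * i + a\<close>.
\<close>

definition occ_sign :: "int list \<Rightarrow> nat \<Rightarrow> int" where
  "occ_sign L p = (if \<exists>q>p. q < length L \<and> L ! q = L ! p then 1 else - 1)"

definition inflate :: "nat \<Rightarrow> int list \<Rightarrow> int list" where
  "inflate r L = map (\<lambda>t. let p = t div (2 * r + 1) in
     (2 * int r + 1) * L ! p + occ_sign L p * displacement r (t mod (2 * r + 1)))
     [0..<(2 * r + 1) * length L]"

lemma length_inflate: "length (inflate r L) = (2 * r + 1) * length L"
  by (simp add: inflate_def)

lemma block_less:
  fixes n p N a :: nat
  assumes "p < N" "a < n"
  shows "n * p + a < n * N"
proof -
  have "n * p + a < n * Suc p" using assms(2) by simp
  also have "\<dots> \<le> n * N" using assms(1) by (intro mult_le_mono2) simp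
  finally show ?thesis .
qed

lemma inflate_nth:
  assumes "p < length L" "a < 2 * r + 1"
  shows "inflate r L ! ((2 * r + 1) * p + a) =
    (2 * int r + 1) * L ! p + occ_sign L p * displacement r a"
proof -
  have "((2 * r + 1) * p + a) div (2 * r + 1) = p" "((2 * r + 1) * p + a) mod (2 * r + 1) = a"
    using assms(2) by (simp_all only: div_mult_self4 mod_mult_self4 div_less mod_less)
  then show ?thesis
    unfolding inflate_def Let_def using block_less[OF assms] by (simp del: mult_Suc add_Suc)
qed

lemma inflate_positions:
  assumes "i < j" and occ: "{t. t < length L \<and> L ! t = k} = {i, j}"
    and a: "a < 2 * r + 1"
  shows "{t. t < (2 * r + 1) * length L \<and>
        inflate r L ! t = (2 * int r + 1) * k + displacement r a} =
      {(2 * r + 1) * i + a, (2 * r + 1) * j + rev_halves r a}" (is "?A = ?B")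
proof -
  have ij: "i < length L" "j < length L" "L ! i = k" "L ! j = k" using occ by auto
  have "occ_sign L i = 1" using ij \<open>i < j\<close> by (auto simp: occ_sign_def)
  moreover have "occ_sign L j = - 1"
  proof -
    have "q \<in> {i, j}" if "q < length L" "L ! q = k" for q using occ that by blast
    then show ?thesis using ij \<open>i < j\<close> by (force simp: occ_sign_def)
  qed
  ultimately have sign: "occ_sign L i = 1" "occ_sign L j = - 1" by auto
  have b: "rev_halves r a < 2 * r + 1" by (rule rev_halves_less[OF a])
  show ?thesis
  proof (intro set_eqI iffI)
    fix t assume "t \<in> ?B"
    then show "t \<in> ?A"
    proof
      assume "t = (2 * r + 1) * i + a"
      then show ?thesis
        using block_less[OF ij(1) a] inflate_nth[OF ij(1) a] ij sign by simp
    next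
      assume "t \<in> {(2 * r + 1) * j + rev_halves r a}"
      then show ?thesis
        using block_less[OF ij(2) b] inflate_nth[OF ij(2) b] ij sign displacement_rev_halves[OF a]
        by simp
    qed
  next
    fix t assume t: "t \<in> ?A"
    define p c where "p = t div (2 * r + 1)" and "c = t mod (2 * r + 1)"
    have tpc: "t = (2 * r + 1) * p + c"
      unfolding p_def c_def by (rule mult_div_mod_eq[symmetric])
    have c: "c < 2 * r + 1" by (simp add: c_def)
    have p: "p < length L"
      using t unfolding p_def by (intro less_mult_imp_div_less) (simp add: mult.commute)
    \<comment> \<open>Uniqueness of the decomposition forces block \<open>p\<close> to come from an
      occurrence of \<open>k\<close>; injectivity of the displacement then fixes the offset
      \<open>c\<close>.\<close>
    have "(2 * int r + 1) * L ! p + occ_sign L p * displacement r c =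
        (2 * int r + 1) * k + displacement r a"
      using t inflate_nth[OF p c] tpc by simp
    moreover have "\<bar>occ_sign L p * displacement r c\<bar> \<le> int r"
      using abs_displacement_le[OF c] by (auto simp: occ_sign_def)
    ultimately have eq: "L ! p = k" "occ_sign L p * displacement r c = displacement r a"
      using int_block_unique abs_displacement_le[OF a] by blast+
    then consider "p = i" | "p = j" using occ p by blast
    then show "t \<in> ?B"
    proof cases
      case 1
      then have "displacement r c = displacement r a" using eq sign by simp
      then have "c = a" using inj_onD[OF inj_on_displacement] a c by blast
      then show ?thesis using tpc 1 by simp
    next
      case 2
      then have "displacement r c = displacement r (rev_halves r a)"
        using eq sign displacement_rev_halves[OF a] by simp
      then have "c = rev_halves r a" using inj_onD[OF inj_on_displacement] b c by blast
      then show ?thesis using tpc 2 by simp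
    qed
  qed
qed

lemma langford_sequence_inflate:
  assumes "langford_sequence m d L"
  shows "langford_sequence (m * (2 * r + 1)) ((2 * int r + 1) * d - int r) (inflate r L)"
proof -
  define n where "n = 2 * int r + 1"
  have d: "0 < d" and len: "length L = 2 * m"
    and occ: "\<And>k. k \<in> {d..d + int m - 1} \<Longrightarrow>
      \<exists>i j. i \<noteq> j \<and> {t. t < 2 * m \<and> L ! t = k} = {i, j} \<and> \<bar>int i - int j\<bar> = k"
    using assms by (auto simp: langford_sequence_def)
  have n: "0 < n" by (simp add: n_def)
  have "n * 1 \<le> n * d" using d n by (intro mult_left_mono) auto
  moreover have "int r < n" by (simp add: n_def)
  ultimately have d': "0 < n * d - int r" by linarith
  have len': "length (inflate r L) = 2 * (m * (2 * r + 1))"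
    by (simp add: length_inflate len algebra_simps)
  have "\<exists>i j. i \<noteq> j \<and> {t. t < 2 * (m * (2 * r + 1)) \<and> inflate r L ! t = K} = {i, j} \<and>
      \<bar>int i - int j\<bar> = K"
    if K: "K \<in> {n * d - int r..n * d - int r + int (m * (2 * r + 1)) - 1}" for K
  proof -
    \<comment> \<open>Rounds \<open>K / n\<close> to the nearest integer, so that the remainder
      \<open>e\<close> is centred at 0.\<close>
    define k where "k = (K + int r) div n"
    define e where "e = (K + int r) mod n - int r"
    have "n * k + (e + int r) = K + int r" by (simp add: k_def e_def)
    then have Kke: "K = n * k + e" by simp
    have "0 \<le> (K + int r) mod n" "(K + int r) mod n < n" using n by simp_all
    then have e: "\<bar>e\<bar> \<le> int r" unfolding e_def using n_def by linarith
    have "K + int r < n * (d + int m)" using K by (simp add: n_def algebra_simps)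
    then have "n * k < n * (d + int m)" using Kke e by linarith
    then have "k < d + int m" using n by simp
    \<comment> \<open>Strict because \<open>e \<le> r < r + 1 = n - r\<close>.\<close>
    moreover have "n * d - int r < n * k + n - int r" using K Kke e n_def by auto
    then have "n * d < n * (k + 1)" by (simp add: algebra_simps)
    then have "d < k + 1" using n by (simp only: mult_less_cancel_left_pos)
    ultimately have "k \<in> {d..d + int m - 1}" by simp
    \<comment> \<open>The pair is put in increasing order, as \<open>occ_sign\<close> treats the
      earlier and the later occurrence differently.\<close>
    from occ[OF this] obtain i j where ij: "i < j" "{t. t < length L \<and> L ! t = k} = {i, j}"
      "int j - int i = k"
    proof (elim exE conjE)
      fix i j assume *: "i \<noteq> j" "{t. t < 2 * m \<and> L ! t = k} = {i, j}" "\<bar>int i - int j\<bar> = k"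
      show thesis
      proof (cases "i < j")
        case True with * show ?thesis by (intro that[of i j]) (auto simp: len)
      next
        case False with * show ?thesis
          by (intro that[of j i]) (auto simp: len insert_commute)
      qed
    qed
    obtain a where a: "a < 2 * r + 1" "displacement r a = e"
      using displacement_surj[OF e] .
    define I J where "I = (2 * r + 1) * i + a" and "J = (2 * r + 1) * j + rev_halves r a"
    have "int J - int I = n * (int j - int i) + displacement r a"
      by (simp add: I_def J_def n_def displacement_def algebra_simps)
    also have "\<dots> = K" using ij(3) a(2) Kke by simp
    finally have diff: "int J - int I = K" .
    have "0 < K" using K d' by simp
    have "{t. t < 2 * (m * (2 * r + 1)) \<and> inflate r L ! t = K} = {I, J}"
      using inflate_positions[OF ij(1,2) a(1)]
      unfolding I_def J_def a(2) Kke n_def len by (simp add: ac_simps)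
    moreover have "I \<noteq> J" "\<bar>int I - int J\<bar> = K" using diff \<open>0 < K\<close> by auto
    ultimately show ?thesis by blast
  qed
  then show ?thesis
    unfolding langford_sequence_def using d' len' by (auto simp: n_def)
qed

theorem theorem3p1:
  fixes m n :: nat and d :: int
  assumes "0 < m" and "0 < d"
    and "\<exists>L. langford_sequence m d L"
    and "odd n" and "0 < n"
  shows "\<exists>L'. langford_sequence (m * n) (int n * d - (int n - 1) div 2) L'"
proof -
  obtain L where L: "langford_sequence m d L" using assms(3) ..
  obtain r where r: "n = 2 * r + 1" using \<open>odd n\<close> by (elim oddE)
  have n: "int n = 2 * int r + 1" by (simp add: r)
  then have half: "(int n - 1) div 2 = int r" by simp
  show ?thesis
    using langford_sequence_inflate[OF L, of r] unfolding half unfolding n unfolding r by blast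
qed

end
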